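(* Let $f_1,\dots,f_n:\mathbb{R}^d\to\mathbb{R}$ be functions and $f=\frac1n\sum_{i=1}^n f_i$. Assume: (i) each $f_i$ is differentiable and bounded from below; (ii) there exists $x\in\mathbb{R}^d$ with $\nabla f_i(x)=0$ for all $i\in\{1,\dots,n\}$; (iii) each $f_i$ is convex; (iv) each $f_i$ is $L_i$-smooth with $L_i>0$, and $L_{\max}=\max_i L_i$; (v) $f$ is $\mu$-strongly convex with $\mu>0$. Let $\gamma>0$, $x_0\in\mathbb{R}^d$, $0\le\varepsilon_2<\frac{\mu}{4L_{\max}}$, and $\alpha\in\left(0,\frac1{\gamma L_\gamma}\right]$, where $L_\gamma$ is the smoothness constant of $M^\gamma$. Let the iterates be generated by $$x_{k+1}=x_k+\alpha\left(\frac1n\sum_{i=1}^n\tilde x_{i,k+1}-x_k\right),\qquad k=0,1,2,\dots,$$ where for every $k$ and every $i$ the point $\tilde x_{i,k+1}\in\mathbb{R}^d$ satisfies $\|\tilde x_{i,k+1}-\mathrm{prox}_{\gamma f_i}(x_k)\|^2\le\varepsilon_2\|x_k-\mathrm{prox}_{\gamma f_i}(x_k)\|^2$. Then for every $K\ge0$, $$\mathcal{E}_K\le\left(1-\left(1-\frac{4\varepsilon_2L_{\max}}{\mu}\right)\cdot\frac{\gamma\mu}{4(1+\gamma L_{\max})}\cdot\alpha\right)^K\mathcal{E}_0,$$ where $\mathcal{E}_k=\gamma M^\gamma(x_k)-\gamma\inf M^\gamma$. In particular, for the largest allowed extrapolation parameter $\alpha=\frac1{\gamma L_\gamma}$ (which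 satisfies $\frac{1}{\gamma L_\gamma}>1$), $$\Delta_K\le\left(1-\left(1-\frac{4\varepsilon_2L_{\max}}{\mu}\right)\cdot\frac{\mu}{4L_\gamma(1+\gamma L_{\max})}\right)^K\cdot\frac{L_\gamma(1+\gamma L_{\max})}{\mu}\,\Delta_0,$$ where $\Delta_k=\|x_k-x_\star\|^2$ and $x_\star$ is a minimizer of $f$.
   Context: $\|\cdot\|$ is the Euclidean norm. $\phi$ is $L$-smooth if $\phi(x)-\phi(y)-\langle\nabla\phi(y),x-y\rangle\le\frac L2\|x-y\|^2$ for all $x,y\in\mathbb{R}^d$; $f$ is $\mu$-strongly convex if $f(x)-f(y)-\langle\nabla f(y),x-y\rangle\ge\frac\mu2\|x-y\|^2$ for all $x,y$. For convex $\phi:\mathbb{R}^d\to\mathbb{R}$ and $\gamma>0$, the proximal operator is $\mathrm{prox}_{\gamma\phi}(x)=\arg\min_{z}\{\phi(z)+\frac1{2\gamma}\|z-x\|^2\}$ and the Moreau envelope is $M^\gamma_\phi(x)=\min_z\{\phi(z)+\frac1{2\gamma}\|z-x\|^2\}$. Set $M^\gamma(x)=\frac1n\sum_{i=1}^n M^\gamma_{f_i}(x)$; this function is convex and smooth, and $L_\gamma$ denotes its smoothness constant (the smallest $L$ for which $M^\gamma$ is $L$-smooth). The iteration is the inexact FedExProx algorithm with constant extrapolation parameter $\alpha$. *)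

theory Defs
  imports "HOL-Analysis.Analysis"
begin

definition grad :: "('a::real_inner \<Rightarrow> real) \<Rightarrow> 'a \<Rightarrow> 'a" where
  "grad \<phi> x = (THE g. GDERIV \<phi> x :> g)"

text \<open>Writing \<open>\<nabla>\<phi>\<close> presupposes that \<open>\<phi>\<close> is differentiable; since \<^const>\<open>grad\<close> is total, this is
  made explicit in the next two definitions.\<close>

definition L_smooth :: "real \<Rightarrow> ('a::real_inner \<Rightarrow> real) \<Rightarrow> bool" where
  "L_smooth L \<phi> \<longleftrightarrow>
     (\<forall>x. \<phi> differentiable (at x)) \<and>
     (\<forall>x y. \<phi> x - \<phi> y - grad \<phi> y \<bullet> (x - y) \<le> L / 2 * (norm (x - y))\<^sup>2)"

definition strongly_convex :: "real \<Rightarrow> ('a::real_inner \<Rightarrow> real) \<Rightarrow> bool" where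
  "strongly_convex \<mu> \<phi> \<longleftrightarrow>
     (\<forall>x. \<phi> differentiable (at x)) \<and>
     (\<forall>x y. \<phi> x - \<phi> y - grad \<phi> y \<bullet> (x - y) \<ge> \<mu> / 2 * (norm (x - y))\<^sup>2)"

definition smoothness_const :: "('a::real_inner \<Rightarrow> real) \<Rightarrow> real" where
  "smoothness_const \<phi> = (LEAST L. L_smooth L \<phi>)"

definition prox :: "real \<Rightarrow> ('a::real_inner \<Rightarrow> real) \<Rightarrow> 'a \<Rightarrow> 'a" where
  "prox \<gamma> \<phi> x = arg_min (\<lambda>z. \<phi> z + 1 / (2 * \<gamma>) * (norm (z - x))\<^sup>2) (\<lambda>z. True)"

text \<open>The minimum over all \<open>z\<close> is the least element of the set of values (\<^const>\<open>Min\<close> is only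
  meaningful for finite sets).\<close>

definition moreau :: "real \<Rightarrow> ('a::real_inner \<Rightarrow> real) \<Rightarrow> 'a \<Rightarrow> real" where
  "moreau \<gamma> \<phi> x = (LEAST v. v \<in> range (\<lambda>z. \<phi> z + 1 / (2 * \<gamma>) * (norm (z - x))\<^sup>2))"

definition average :: "nat \<Rightarrow> (nat \<Rightarrow> 'a \<Rightarrow> real) \<Rightarrow> 'a \<Rightarrow> real" where
  "average n f x = 1 / real n * (\<Sum>i=1..n. f i x)"

definition avg_moreau :: "nat \<Rightarrow> real \<Rightarrow> (nat \<Rightarrow> 'a::real_inner \<Rightarrow> real) \<Rightarrow> 'a \<Rightarrow> real" where
  "avg_moreau n \<gamma> f = average n (\<lambda>i. moreau \<gamma> (f i))"

text \<open>\<open>x k\<close> is the \<open>k\<close>-th iterate, \<open>xt i (Suc k)\<close> the inexact proximal point computed by client \<open>i\<close>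
  from \<open>x k\<close>, with relative accuracy \<open>\<epsilon>\<close>; \<open>\<alpha>\<close> is the extrapolation parameter.\<close>

definition inexact_fedexprox ::
  "nat \<Rightarrow> (nat \<Rightarrow> 'a::real_inner \<Rightarrow> real) \<Rightarrow> real \<Rightarrow> real \<Rightarrow> real \<Rightarrow>
   (nat \<Rightarrow> nat \<Rightarrow> 'a) \<Rightarrow> (nat \<Rightarrow> 'a) \<Rightarrow> bool" where
  "inexact_fedexprox n f \<gamma> \<epsilon> \<alpha> xt x \<longleftrightarrow>
     (\<forall>k. \<forall>i\<in>{1..n}.
        (norm (xt i (Suc k) - prox \<gamma> (f i) (x k)))\<^sup>2
          \<le> \<epsilon> * (norm (x k - prox \<gamma> (f i) (x k)))\<^sup>2) \<and>
     (\<forall>k. x (Suc k) = x k + \<alpha> *\<^sub>R ((1 / real n) *\<^sub>R (\<Sum>i=1..n. xt i (Suc k)) - x k))"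

end

(* The iteration is gradient descent on M, the average of the Moreau envelopes, with step
   alpha * gamma and a gradient error e. Each envelope is convex and kappa-smooth with
   kappa = L / (1 + gamma L), and all envelopes share the common minimizer z of the f_i, so
   |e|^2 <= epsilon * 2 kappa (M - M z). Moreover f - f z <= (1 + gamma L) (M - M z), so strong
   convexity of f gives quadratic growth of M with constant c = mu / (1 + gamma L), hence the
   Polyak-Lojasiewicz inequality |grad M|^2 >= c/2 (M - M z). The descent inequality for step
   at most 1/L_gamma then contracts M - M z by 1 - alpha gamma (c/4 - epsilon kappa). Quadratic
   growth and L_gamma-smoothness at z turn this into the bound on distances; comparing them also
   gives c <= L_gamma, so that the contraction factor is nonnegative. *)

theory Submission
  imports Defs
begin

section \<open>Gradients and smoothness\<close>

lemma grad_eqI: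
  fixes \<phi> :: "'a::real_inner \<Rightarrow> real"
  assumes "GDERIV \<phi> x :> g"
  shows "grad \<phi> x = g"
  unfolding grad_def
proof (rule the_equality)
  fix h assume "GDERIV \<phi> x :> h"
  then have "(\<lambda>v. v \<bullet> h) = (\<lambda>v. v \<bullet> g)"
    using assms has_derivative_unique unfolding gderiv_def by blast
  then show "h = g"
    by (metis vector_eq_rdot inner_commute)
qed (fact assms)

text \<open>In finite dimension the linear functional \<open>D\<close> is represented by the vector
  \<open>adjoint D 1\<close>, which is therefore the gradient.\<close>

lemma GDERIV_grad:
  fixes \<phi> :: "'a::euclidean_space \<Rightarrow> real"
  assumes "\<phi> differentiable (at x)"
  shows "GDERIV \<phi> x :> grad \<phi> x"
proof -
  obtain D where D: "(\<phi> has_derivative D) (at x)"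
    using assms unfolding differentiable_def by blast
  then have "(\<lambda>h. h \<bullet> adjoint D 1) = D"
    using adjoint_works[OF has_derivative_linear[OF D]] by auto
  then have "GDERIV \<phi> x :> adjoint D 1"
    using D by (simp add: gderiv_def)
  then show ?thesis
    using grad_eqI by metis
qed

lemma GDERIV_sum:
  assumes "\<And>i. i \<in> I \<Longrightarrow> GDERIV (f i) x :> g i"
  shows "GDERIV (\<lambda>y. \<Sum>i\<in>I. f i y) x :> (\<Sum>i\<in>I. g i)"
  using assms unfolding gderiv_def inner_sum_right by (intro has_derivative_sum)

section \<open>Averages of functions\<close>

lemma GDERIV_average:
  fixes f :: "nat \<Rightarrow> 'a::real_inner \<Rightarrow> real"
  assumes "\<And>i. i \<in> {1..n} \<Longrightarrow> GDERIV (f i) x :> g i"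
  shows "GDERIV (average n f) x :> (1 / real n) *\<^sub>R (\<Sum>i=1..n. g i)"
  using GDERIV_mult[OF GDERIV_const[where k = "1 / real n"] GDERIV_sum[of "{1..n}" f x g]] assms
  by (simp add: average_def[abs_def])

lemma average_le_average:
  assumes "\<And>i. i \<in> {1..n} \<Longrightarrow> f i x \<le> g i y"
  shows "average n f x \<le> average n g y"
  unfolding average_def using assms by (intro mult_left_mono sum_mono) auto

lemma average_mult: "average n (\<lambda>i y. C * g i y) x = C * average n g x"
  by (simp add: average_def sum_distrib_left mult.left_commute)

lemma average_diff: "average n (\<lambda>i y. g i y - h i y) x = average n g x - average n h x"
  by (simp add: average_def sum_subtractf right_diff_distrib)

text \<open>Along the segment from \<open>x\<close> to \<open>y\<close>, convexity bounds every
  difference quotient with 0 < t < 1 by \<open>\<phi> y - \<phi> x\<close>; as t decreases to 0 the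
  quotients tend to the directional derivative.\<close>

lemma convex_on_imp_above_tangent_plane:
  fixes \<phi> :: "'a::real_inner \<Rightarrow> real"
  assumes "convex_on UNIV \<phi>" and g: "GDERIV \<phi> x :> g"
  shows "\<phi> x + g \<bullet> (y - x) \<le> \<phi> y"
proof -
  define h where "h t = \<phi> (x + t *\<^sub>R (y - x))" for t :: real
  have "((\<lambda>t. x + t *\<^sub>R (y - x)) has_derivative (\<lambda>t. t *\<^sub>R (y - x))) (at 0)"
    by (auto intro!: derivative_eq_intros)
  moreover have "(\<phi> has_derivative (\<lambda>v. v \<bullet> g)) (at (x + 0 *\<^sub>R (y - x)))"
    using g by (simp add: gderiv_def)
  ultimately have "(h has_derivative (\<lambda>t. (t *\<^sub>R (y - x)) \<bullet> g)) (at 0)"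
    unfolding h_def by (rule has_derivative_compose)
  then have "(h has_real_derivative g \<bullet> (y - x)) (at 0)"
    unfolding has_field_derivative_def
    by (rule has_derivative_eq_rhs) (simp add: fun_eq_iff inner_commute)
  then have "((\<lambda>t. (h t - h 0) / t) \<longlongrightarrow> g \<bullet> (y - x)) (at_right 0)"
    by (simp add: has_field_derivative_iff filterlim_at_split)
  moreover have "eventually (\<lambda>t. (h t - h 0) / t \<le> \<phi> y - \<phi> x) (at_right 0)"
  proof (rule eventually_at_rightI)
    fix t :: real assume t: "t \<in> {0<..<1}"
    have "\<phi> ((1 - t) *\<^sub>R x + t *\<^sub>R y) \<le> (1 - t) * \<phi> x + t * \<phi> y"
      using assms(1) t by (intro convex_onD) auto
    then show "(h t - h 0) / t \<le> \<phi> y - \<phi> x"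
      using t by (simp add: h_def field_simps algebra_simps)
  qed simp
  ultimately have "g \<bullet> (y - x) \<le> \<phi> y - \<phi> x"
    by (intro tendsto_upperbound) auto
  then show ?thesis by simp
qed

section \<open>Smoothness inequalities and the least smoothness constant\<close>

lemma L_smoothD:
  fixes \<phi> :: "'a::real_inner \<Rightarrow> real"
  assumes "L_smooth L \<phi>"
  shows "\<phi> y \<le> \<phi> x + grad \<phi> x \<bullet> (y - x) + L / 2 * (norm (y - x))\<^sup>2"
  using assms unfolding L_smooth_def by (smt (verit))

lemma L_smooth_mono:
  fixes \<phi> :: "'a::real_inner \<Rightarrow> real"
  assumes "L_smooth L \<phi>" "L \<le> L'"
  shows "L_smooth L' \<phi>"
  unfolding L_smooth_def
proof (intro conjI allI)
  fix x y :: 'a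
  have "L / 2 * (norm (x - y))\<^sup>2 \<le> L' / 2 * (norm (x - y))\<^sup>2"
    using assms(2) by (intro mult_right_mono) auto
  then show "\<phi> x - \<phi> y - grad \<phi> y \<bullet> (x - y) \<le> L' / 2 * (norm (x - y))\<^sup>2"
    using L_smoothD[OF assms(1), of x y] by linarith
qed (use assms(1) in \<open>simp add: L_smooth_def\<close>)

text \<open>A gradient step of length 1 / L minimizes the quadratic upper model at \<open>x\<close>,
  and even there the model cannot fall below \<open>m\<close>.\<close>

lemma L_smooth_grad_bound:
  assumes "L_smooth L \<phi>" and L: "L > 0" and m: "\<And>y. m \<le> \<phi> y"
  shows "(norm (grad \<phi> x))\<^sup>2 \<le> 2 * L * (\<phi> x - m)"
proof -
  let ?g = "grad \<phi> x"
  have "m \<le> \<phi> x + ?g \<bullet> (- (1 / L) *\<^sub>R ?g) + L / 2 * (norm (- (1 / L) *\<^sub>R ?g))\<^sup>2"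
    using m[of "x - (1 / L) *\<^sub>R ?g"] L_smoothD[OF assms(1), of "x - (1 / L) *\<^sub>R ?g" x] by simp
  also have "\<dots> = \<phi> x - (norm ?g)\<^sup>2 / (2 * L)"
    using L by (simp add: power_mult_distrib dot_square_norm power2_eq_square field_simps)
  finally show ?thesis
    using L by (simp add: field_simps)
qed

text \<open>The lower bound \<open>c\<close> on all smoothness constants makes the least one exist.\<close>

lemma smoothness_const:
  fixes \<phi> :: "'a::real_inner \<Rightarrow> real"
  assumes l: "L_smooth l \<phi>" and c: "\<And>L. L_smooth L \<phi> \<Longrightarrow> c \<le> L"
  shows L_smooth_smoothness_const: "L_smooth (smoothness_const \<phi>) \<phi>"
    and smoothness_const_le: "L_smooth L \<phi> \<Longrightarrow> smoothness_const \<phi> \<le> L"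
proof -
  let ?S = "{L. L_smooth L \<phi>}"
  define K where "K = Inf ?S"
  have bdd: "bdd_below ?S"
    by (rule bdd_belowI[of _ c]) (use c in auto)
  have "L_smooth (K) \<phi>"
    unfolding L_smooth_def
  proof (intro conjI allI)
    fix x y
    show "\<phi> x - \<phi> y - grad \<phi> y \<bullet> (x - y) \<le> K / 2 * (norm (x - y))\<^sup>2"
    proof (cases "x = y")
      case False
      then have pos: "(norm (x - y))\<^sup>2 > 0" by simp
      \<comment> \<open>For a fixed pair of distinct points, smoothness with constant L says that L
        dominates this ratio. The infimum of all such L dominates it too, so the infimum is
        attained.\<close>
      have "2 * (\<phi> x - \<phi> y - grad \<phi> y \<bullet> (x - y)) / (norm (x - y))\<^sup>2 \<le> K"
      unfolding K_def
      proof (rule cInf_greatest)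
        fix L assume "L \<in> ?S"
        then show "2 * (\<phi> x - \<phi> y - grad \<phi> y \<bullet> (x - y)) / (norm (x - y))\<^sup>2 \<le> L"
          using L_smoothD[of L \<phi> x y] pos by (simp add: pos_divide_le_eq)
      qed (use l in auto)
      then show ?thesis
        using pos by (simp add: pos_divide_le_eq)
    qed simp
  qed (use l in \<open>simp add: L_smooth_def\<close>)
  moreover have le: "K \<le> L" if "L_smooth L \<phi>" for L
    unfolding K_def using that bdd by (auto intro: cInf_lower)
  ultimately have eq: "smoothness_const \<phi> = K"
    unfolding smoothness_const_def by (intro Least_equality) auto
  show "L_smooth (smoothness_const \<phi>) \<phi>"
    unfolding eq by fact
  show "smoothness_const \<phi> \<le> L" if "L_smooth L \<phi>"
    unfolding eq using that by (rule le)
qed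

text \<open>The first-order remainder lies between 0 and a multiple of the squared distance.
  Differentiability is a conclusion here; the envelopes obtain theirs in this way.\<close>

lemma GDERIV_sandwich:
  fixes \<phi> :: "'a::real_inner \<Rightarrow> real"
  assumes lower: "\<And>y. \<phi> x + g \<bullet> (y - x) \<le> \<phi> y"
    and upper: "\<And>y. \<phi> y \<le> \<phi> x + g \<bullet> (y - x) + C * (norm (y - x))\<^sup>2"
  shows "GDERIV \<phi> x :> g"
  unfolding gderiv_def
proof (rule has_derivativeI_sandwich[where e = 1])
  show "norm (\<phi> y - \<phi> x - (y - x) \<bullet> g) / norm (y - x) \<le> C * norm (y - x)" if "y \<noteq> x" for y
    using lower[of y] upper[of y] that
    by (simp add: divide_le_eq inner_commute power2_eq_square mult.assoc)
  have "((\<lambda>y. C * norm (y - x)) \<longlongrightarrow> C * norm (x - x)) (at x)"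
    by (intro tendsto_intros)
  then show "((\<lambda>y. C * norm (y - x)) \<longlongrightarrow> 0) (at x)"
    by simp
qed (auto intro: bounded_linear_inner_left)

section \<open>The Moreau envelope\<close>

locale moreau_envelope =
  fixes f :: "'a::euclidean_space \<Rightarrow> real" and \<gamma> :: real
  assumes differentiable: "f differentiable (at x)"
    and convex: "convex_on UNIV f"
    and bounded_below: "bdd_below (range f)"
    and gamma_pos: "\<gamma> > 0"
begin

text \<open>Continuity gives a minimizer on a compact ball around \<open>x\<close>; outside it the
  quadratic term alone lifts the objective to at least \<open>f x\<close>, its value at the
  centre.\<close>

lemma ex_prox: "\<exists>p. \<forall>z. f p + 1 / (2 * \<gamma>) * (norm (p - x))\<^sup>2 \<le> f z + 1 / (2 * \<gamma>) * (norm (z - x))\<^sup>2"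
proof -
  obtain m where m: "\<And>z. m \<le> f z"
    using bounded_below by (auto simp: bdd_below_def)
  let ?F = "\<lambda>z. f z + 1 / (2 * \<gamma>) * (norm (z - x))\<^sup>2"
  \<comment> \<open>Chosen so that at distance \<open>r\<close> the quadratic term equals
    \<open>f x - m\<close>.\<close>
  define r where "r = sqrt (2 * \<gamma> * (f x - m))"
  have "continuous_on UNIV f"
    using differentiable by (meson continuous_at_imp_continuous_on differentiable_imp_continuous_within)
  then have "continuous_on (cball x r) ?F"
    by (intro continuous_intros) (auto intro: continuous_on_subset)
  moreover have "r \<ge> 0"
    using m[of x] gamma_pos by (simp add: r_def)
  ultimately obtain p where p: "p \<in> cball x r" "\<And>z. z \<in> cball x r \<Longrightarrow> ?F p \<le> ?F z"
    using continuous_attains_inf[of "cball x r" ?F] by auto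
  have "?F p \<le> ?F z" for z
  proof (cases "z \<in> cball x r")
    case False
    then have "r < norm (z - x)"
      by (simp add: dist_norm norm_minus_commute)
    then have "r\<^sup>2 \<le> (norm (z - x))\<^sup>2"
      using \<open>r \<ge> 0\<close> by (simp add: power_mono)
    then have "2 * \<gamma> * (f x - m) \<le> (norm (z - x))\<^sup>2"
      using m[of x] gamma_pos by (simp add: r_def)
    then have "f x - m \<le> 1 / (2 * \<gamma>) * (norm (z - x))\<^sup>2"
      using gamma_pos by (simp add: field_simps)
    then have "f x \<le> ?F z"
      using m[of z] by linarith
    moreover have "?F p \<le> f x"
      using p(2)[of x] \<open>r \<ge> 0\<close> by simp
    ultimately show ?thesis by linarith
  qed (use p in auto)
  then show ?thesis by blast
qed

lemma prox_le:
  "f (prox \<gamma> f x) + 1 / (2 * \<gamma>) * (norm (prox \<gamma> f x - x))\<^sup>2 \<le> f z + 1 / (2 * \<gamma>) * (norm (z - x))\<^sup>2"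
proof -
  let ?F = "\<lambda>z. f z + 1 / (2 * \<gamma>) * (norm (z - x))\<^sup>2"
  obtain p where p: "\<And>z. ?F p \<le> ?F z"
    using ex_prox by blast
  show ?thesis
    unfolding prox_def by (rule arg_minI[where P = "\<lambda>_. True" and x = p and f = ?F]) (use p in \<open>auto simp: not_less\<close>)
qed

lemma moreau_eq: "moreau \<gamma> f x = f (prox \<gamma> f x) + 1 / (2 * \<gamma>) * (norm (prox \<gamma> f x - x))\<^sup>2"
  unfolding moreau_def by (rule Least_equality) (use prox_le in blast)+

lemma moreau_le: "moreau \<gamma> f x \<le> f z + 1 / (2 * \<gamma>) * (norm (z - x))\<^sup>2"
  unfolding moreau_eq by (rule prox_le)

text \<open>Fermat's rule: the gradient \<open>?D\<close> of the proximal objective vanishes at its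
  minimizer.\<close>

lemma grad_prox: "grad f (prox \<gamma> f x) = (1 / \<gamma>) *\<^sub>R (x - prox \<gamma> f x)"
proof -
  let ?p = "prox \<gamma> f x" and ?F = "\<lambda>z. f z + 1 / (2 * \<gamma>) * (norm (z - x))\<^sup>2"
  let ?D = "grad f ?p + (1 / \<gamma>) *\<^sub>R (?p - x)"
  have "(f has_derivative (\<lambda>h. h \<bullet> grad f ?p)) (at ?p)"
    using GDERIV_grad[OF differentiable] by (simp add: gderiv_def)
  moreover have "((\<lambda>z. 1 / (2 * \<gamma>) * ((z - x) \<bullet> (z - x))) has_derivative
      (\<lambda>h. h \<bullet> ((1 / \<gamma>) *\<^sub>R (?p - x)))) (at ?p)"
    using gamma_pos
    by (auto intro!: derivative_eq_intros simp: fun_eq_iff inner_commute simp flip: scaleR_diff_right)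
  ultimately have "(?F has_derivative (\<lambda>h. h \<bullet> ?D)) (at ?p)"
    unfolding power2_norm_eq_inner inner_add_right by (rule has_derivative_add)
  moreover have "(\<forall>y\<in>UNIV. ?F y \<le> ?F ?p) \<or> (\<forall>y\<in>UNIV. ?F ?p \<le> ?F y)"
    using prox_le by blast
  ultimately have "(\<lambda>h. h \<bullet> ?D) = (\<lambda>h. 0)"
    by (intro differential_zero_maxmin[of ?p UNIV ?F]) auto
  then have "?D \<bullet> ?D = 0" by metis
  then have "grad f ?p = - ((1 / \<gamma>) *\<^sub>R (?p - x))"
    by (simp add: eq_neg_iff_add_eq_0)
  then show ?thesis
    by (simp add: scaleR_diff_right)
qed

lemma above_tangent: "f x + grad f x \<bullet> (y - x) \<le> f y"
  using convex GDERIV_grad[OF differentiable] by (rule convex_on_imp_above_tangent_plane)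

text \<open>The slope \<open>g\<close> is the gradient of \<open>f\<close> at \<open>p\<close>, so
  the tangent of \<open>f\<close> at \<open>p\<close> bounds \<open>f q\<close> from below. What
  remains of the claim is a complete square, that of \<open>q - x + \<gamma> g\<close>.\<close>

lemma moreau_lower: "moreau \<gamma> f y + (1 / \<gamma>) *\<^sub>R (y - prox \<gamma> f y) \<bullet> (x - y) \<le> moreau \<gamma> f x"
proof -
  define p q g where "p = prox \<gamma> f y" and "q = prox \<gamma> f x" and "g = (1 / \<gamma>) *\<^sub>R (y - p)"
  have y: "y = p + \<gamma> *\<^sub>R g"
    using gamma_pos by (simp add: g_def)
  have "0 \<le> 1 / (2 * \<gamma>) * (norm (q - x + \<gamma> *\<^sub>R g))\<^sup>2"
    using gamma_pos by simp
  also have "\<dots> = g \<bullet> (q - p) - g \<bullet> (x - y) + 1 / (2 * \<gamma>) * (norm (q - x))\<^sup>2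
      - 1 / (2 * \<gamma>) * (norm (p - y))\<^sup>2"
    unfolding y power2_norm_eq_inner using gamma_pos
    by (simp add: inner_simps inner_commute field_simps)
  finally show ?thesis
    using above_tangent[of p q] grad_prox[of y]
    by (simp add: moreau_eq p_def q_def g_def)
qed

lemma le_moreau:
  assumes "\<And>y. m \<le> f y"
  shows "m \<le> moreau \<gamma> f x"
  using assms[of "prox \<gamma> f x"] gamma_pos unfolding moreau_eq by (simp add: add_increasing2)

text \<open>Comparing at \<open>z = prox y + t (x - y)\<close> with \<open>t = 1 / (1 + \<gamma> L)\<close>, the minimizer of
  \<open>L t\<^sup>2 + (1 - t)\<^sup>2 / \<gamma>\<close>.\<close>

lemma moreau_upper:
  assumes L: "L_smooth L f" "L > 0"
  shows "moreau \<gamma> f x \<le> moreau \<gamma> f y + (1 / \<gamma>) *\<^sub>R (y - prox \<gamma> f y) \<bullet> (x - y)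
    + L / (1 + \<gamma> * L) / 2 * (norm (x - y))\<^sup>2"
proof -
  define p g d t where "p = prox \<gamma> f y" and "g = (1 / \<gamma>) *\<^sub>R (y - p)" and "d = x - y"
    and "t = 1 / (1 + \<gamma> * L)"
  have nz: "1 + \<gamma> * L > 0"
    using gamma_pos L by (simp add: add_pos_pos)
  then have t1: "1 - t = \<gamma> * L * t"
    by (simp add: t_def field_simps)
  have t2: "t * (1 + \<gamma> * L) = 1"
    using nz by (simp add: t_def)
  have y: "y = p + \<gamma> *\<^sub>R g"
    using gamma_pos by (simp add: g_def)
  have zx: "p + t *\<^sub>R d - x = - (\<gamma> *\<^sub>R g + (1 - t) *\<^sub>R d)"
    by (simp add: d_def y algebra_simps)
  have "moreau \<gamma> f x \<le> f (p + t *\<^sub>R d) + 1 / (2 * \<gamma>) * (norm (p + t *\<^sub>R d - x))\<^sup>2"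
    by (rule moreau_le)
  also have "f (p + t *\<^sub>R d) \<le> f p + g \<bullet> (t *\<^sub>R d) + L / 2 * (norm (t *\<^sub>R d))\<^sup>2"
    using L_smoothD[OF L(1), of "p + t *\<^sub>R d" p] grad_prox[of y] by (simp add: p_def g_def)
  also have "1 / (2 * \<gamma>) * (norm (p + t *\<^sub>R d - x))\<^sup>2
      = \<gamma> / 2 * (g \<bullet> g) + (1 - t) * (g \<bullet> d) + (1 - t)\<^sup>2 / (2 * \<gamma>) * (d \<bullet> d)"
    unfolding zx norm_minus_cancel power2_norm_eq_inner using gamma_pos
    by (simp add: inner_simps inner_commute power2_eq_square field_simps)
  also have "f p + g \<bullet> (t *\<^sub>R d) + L / 2 * (norm (t *\<^sub>R d))\<^sup>2
      + (\<gamma> / 2 * (g \<bullet> g) + (1 - t) * (g \<bullet> d) + (1 - t)\<^sup>2 / (2 * \<gamma>) * (d \<bullet> d))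
    = f p + \<gamma> / 2 * (g \<bullet> g) + g \<bullet> d + (L * t\<^sup>2 + (1 - t)\<^sup>2 / \<gamma>) / 2 * (d \<bullet> d)"
    using gamma_pos unfolding power2_norm_eq_inner
    by (simp add: power2_eq_square field_simps)
  \<comment> \<open>Since 1 - t = \<gamma> L t, the second term is \<gamma> L^2 t^2, and t (1 +
    \<gamma> L) = 1 then absorbs one factor t.\<close>
  also have "L * t\<^sup>2 + (1 - t)\<^sup>2 / \<gamma> = L * t * (t * (1 + \<gamma> * L))"
    unfolding t1 using gamma_pos by (simp add: power2_eq_square field_simps)
  also have "\<dots> = L / (1 + \<gamma> * L)"
    unfolding t2 by (simp add: t_def)
  also have "\<gamma> / 2 * (g \<bullet> g) = 1 / (2 * \<gamma>) * (norm (p - y))\<^sup>2"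
    unfolding y power2_norm_eq_inner using gamma_pos by (simp add: field_simps)
  finally show ?thesis
    by (simp add: moreau_eq p_def g_def d_def power2_norm_eq_inner)
qed

lemma GDERIV_moreau:
  assumes "L_smooth L f" "L > 0"
  shows "GDERIV (moreau \<gamma> f) x :> (1 / \<gamma>) *\<^sub>R (x - prox \<gamma> f x)"
  by (rule GDERIV_sandwich[OF moreau_lower moreau_upper[OF assms]])

lemma grad_moreau:
  assumes "L_smooth L f" "L > 0"
  shows "grad (moreau \<gamma> f) x = (1 / \<gamma>) *\<^sub>R (x - prox \<gamma> f x)"
  by (rule grad_eqI[OF GDERIV_moreau[OF assms]])

lemma L_smooth_moreau:
  assumes L: "L_smooth L f" "L > 0"
  shows "L_smooth (L / (1 + \<gamma> * L)) (moreau \<gamma> f)"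
  unfolding L_smooth_def
proof (intro conjI allI)
  show "moreau \<gamma> f differentiable (at x)" for x
    using GDERIV_moreau[OF L] unfolding gderiv_def differentiable_def by blast
  show "moreau \<gamma> f x - moreau \<gamma> f y - grad (moreau \<gamma> f) y \<bullet> (x - y)
      \<le> L / (1 + \<gamma> * L) / 2 * (norm (x - y))\<^sup>2" for x y
    using moreau_upper[OF L, of x y] by (simp add: grad_moreau[OF L])
qed

text \<open>Carries growth of \<open>f\<close> over to its envelope. Smoothness at \<open>p\<close>
  bounds \<open>f x\<close> by \<open>f p\<close> plus a multiple of |g|^2, because x - p = \<gamma>
  g. The envelope value covers all of this but \<gamma>/2 |g|^2, which the gradient bound at
  \<open>p\<close> pays for with \<gamma> L (f p - m).\<close>

lemma moreau_growth:
  assumes L: "L_smooth L f" "L > 0" and m: "\<And>y. m \<le> f y"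
  shows "f x - m \<le> (1 + \<gamma> * L) * (moreau \<gamma> f x - m)"
proof -
  define p g where "p = prox \<gamma> f x" and "g = (1 / \<gamma>) *\<^sub>R (x - p)"
  have x: "x = p + \<gamma> *\<^sub>R g"
    using gamma_pos by (simp add: g_def)
  have gp: "grad f p = g"
    using grad_prox by (simp add: p_def g_def)
  have "f x \<le> f p + g \<bullet> (\<gamma> *\<^sub>R g) + L / 2 * (norm (\<gamma> *\<^sub>R g))\<^sup>2"
    using L_smoothD[OF L(1), of x p] unfolding gp by (simp add: x)
  also have "\<dots> = f p + (\<gamma> + L * \<gamma>\<^sup>2 / 2) * (norm g)\<^sup>2"
    by (simp add: power_mult_distrib dot_square_norm algebra_simps)
  finally have 1: "f x \<le> f p + (\<gamma> + L * \<gamma>\<^sup>2 / 2) * (norm g)\<^sup>2" .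
  have "(norm g)\<^sup>2 \<le> 2 * L * (f p - m)"
    using L_smooth_grad_bound[OF L m, of p] by (simp add: gp)
  then have 2: "\<gamma> / 2 * (norm g)\<^sup>2 \<le> \<gamma> / 2 * (2 * L * (f p - m))"
    using gamma_pos by (intro mult_left_mono) auto
  have "moreau \<gamma> f x = f p + 1 / (2 * \<gamma>) * (norm (\<gamma> *\<^sub>R g))\<^sup>2"
    unfolding moreau_eq p_def[symmetric] by (simp add: x)
  also have "\<dots> = f p + \<gamma> / 2 * (norm g)\<^sup>2"
    using gamma_pos by (simp add: power_mult_distrib power2_eq_square)
  finally have "(1 + \<gamma> * L) * (moreau \<gamma> f x - m)
      = f p - m + \<gamma> * L * (f p - m) + (1 + \<gamma> * L) * (\<gamma> / 2) * (norm g)\<^sup>2"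
    by (simp add: algebra_simps)
  moreover have "(\<gamma> + L * \<gamma>\<^sup>2 / 2) * (norm g)\<^sup>2
      = \<gamma> / 2 * (norm g)\<^sup>2 + (1 + \<gamma> * L) * (\<gamma> / 2) * (norm g)\<^sup>2"
    by (simp add: field_simps power2_eq_square)
  ultimately show ?thesis
    using 1 2 by (simp add: algebra_simps)
qed

end


section \<open>Inexact gradient descent on the averaged envelope\<close>

text \<open>Triangle inequality followed by Cauchy-Schwarz; for n = 0 both sides are 0.\<close>

lemma norm_average_le:
  fixes v :: "nat \<Rightarrow> 'a::real_normed_vector"
  shows "(norm ((1 / real n) *\<^sub>R (\<Sum>i=1..n. v i)))\<^sup>2 \<le> 1 / real n * (\<Sum>i=1..n. (norm (v i))\<^sup>2)"
proof (cases "n = 0")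
  case False
  have "(norm (\<Sum>i=1..n. v i))\<^sup>2 \<le> (\<Sum>i=1..n. norm (v i))\<^sup>2"
    by (intro power_mono norm_sum) auto
  also have "\<dots> \<le> (\<Sum>i=1..n. (norm (v i))\<^sup>2) * real n"
    using sum_squared_le_sum_of_squares[of "\<lambda>i. norm (v i)" "{1..n}"] by simp
  finally show ?thesis
    using False by (simp add: power_mult_distrib power2_eq_square field_simps)
qed simp

text \<open>With h = g + e, the step size condition leaves at most s (|h|^2 / 2 - g . h), and this
  equals s (|e|^2 - |g|^2) / 2: the cross terms cancel, so no relation between the error and the
  gradient enters.\<close>

lemma inexact_gradient_step:
  fixes \<phi> :: "'a::real_inner \<Rightarrow> real"
  assumes "L_smooth \<Lambda> \<phi>" and s: "s > 0" "s * \<Lambda> \<le> 1"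
  shows "\<phi> (x - s *\<^sub>R (grad \<phi> x + e)) \<le> \<phi> x - s / 2 * (norm (grad \<phi> x))\<^sup>2 + s / 2 * (norm e)\<^sup>2"
proof -
  define g h where "g = grad \<phi> x" and "h = g + e"
  have "\<phi> (x - s *\<^sub>R h) \<le> \<phi> x + g \<bullet> (- (s *\<^sub>R h)) + \<Lambda> / 2 * (norm (s *\<^sub>R h))\<^sup>2"
    using L_smoothD[OF assms(1), of "x - s *\<^sub>R h" x] by (simp add: g_def)
  also have "\<dots> = \<phi> x - s * (g \<bullet> h) + s / 2 * ((s * \<Lambda>) * (norm h)\<^sup>2)"
    by (simp add: power_mult_distrib power2_eq_square)
  also have "\<dots> \<le> \<phi> x - s * (g \<bullet> h) + s / 2 * (1 * (norm h)\<^sup>2)"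
    using s by (intro add_left_mono mult_left_mono mult_right_mono) auto
  also have "\<dots> = \<phi> x - s / 2 * (norm g)\<^sup>2 + s / 2 * (norm e)\<^sup>2"
    unfolding h_def power2_norm_eq_inner
    by (simp add: inner_simps inner_commute field_simps)
  finally show ?thesis
    by (simp add: g_def h_def)
qed

text \<open>Convexity and Cauchy-Schwarz give \<delta> <= |g| |x - z|, while growth gives |x - z|^2
  <= 2 \<delta> / c. Squaring the first and cancelling one \<delta> leaves the constant c / 2, where
  strong convexity would give 2 c.\<close>

lemma quadratic_growth_imp_PL:
  fixes x z g :: "'a::real_inner"
  assumes "\<phi> x + g \<bullet> (z - x) \<le> \<phi> z" and c: "c > 0" and growth: "c / 2 * (norm (x - z))\<^sup>2 \<le> \<phi> x - \<phi> z"
  shows "c / 2 * (\<phi> x - \<phi> z) \<le> (norm g)\<^sup>2"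
proof -
  define \<delta> where "\<delta> = \<phi> x - \<phi> z"
  have \<delta>0: "\<delta> \<ge> 0"
    using growth c unfolding \<delta>_def by (smt (verit) divide_pos_pos mult_nonneg_nonneg zero_le_power2)
  show ?thesis
  proof (cases "\<delta> = 0")
    case False
    have "\<delta> \<le> g \<bullet> (x - z)"
      using assms(1) by (simp add: \<delta>_def inner_diff_right)
    also have "\<dots> \<le> norm g * norm (x - z)"
      by (rule norm_cauchy_schwarz)
    finally have "\<delta>\<^sup>2 \<le> (norm g * norm (x - z))\<^sup>2"
      using \<delta>0 by (rule power_mono)
    then have "c / 2 * \<delta>\<^sup>2 \<le> c / 2 * ((norm g)\<^sup>2 * (norm (x - z))\<^sup>2)"
      using c by (intro mult_left_mono) (auto simp: power_mult_distrib)
    also have "\<dots> = (norm g)\<^sup>2 * (c / 2 * (norm (x - z))\<^sup>2)"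
      by simp
    also have "\<dots> \<le> (norm g)\<^sup>2 * \<delta>"
      using growth by (intro mult_left_mono) (auto simp: \<delta>_def)
    finally have "(c / 2 * \<delta>) * \<delta> \<le> (norm g)\<^sup>2 * \<delta>"
      by (simp add: power2_eq_square mult.assoc)
    then show ?thesis
      using False \<delta>0 by (simp add: \<delta>_def)
  qed (simp add: \<delta>_def[symmetric])
qed

section \<open>The averaged envelope of functions with a common minimizer\<close>

locale interpolated_sum =
  fixes n :: nat and f :: "nat \<Rightarrow> 'a::euclidean_space \<Rightarrow> real" and L \<mu> \<gamma> :: real and z :: 'a
  assumes n_ge_1: "n \<ge> 1"
    and envelope: "i \<in> {1..n} \<Longrightarrow> moreau_envelope (f i) \<gamma>"
    and smooth: "i \<in> {1..n} \<Longrightarrow> L_smooth L (f i)"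
    and grad_zero: "i \<in> {1..n} \<Longrightarrow> grad (f i) z = 0"
    and strongly_convex: "strongly_convex \<mu> (average n f)"
    and L_pos: "L > 0" and \<mu>_pos: "\<mu> > 0" and \<gamma>_pos: "\<gamma> > 0"
begin

abbreviation M where "M \<equiv> avg_moreau n \<gamma> f"

definition \<kappa> where "\<kappa> = L / (1 + \<gamma> * L)"

definition c where "c = \<mu> / (1 + \<gamma> * L)"

lemma denom_pos: "1 + \<gamma> * L > 0"
  using L_pos \<gamma>_pos by (simp add: add_pos_pos)

lemma \<kappa>_pos: "\<kappa> > 0"
  using L_pos denom_pos by (simp add: \<kappa>_def)

lemma c_pos: "c > 0"
  using \<mu>_pos denom_pos by (simp add: c_def)

lemma f_min:
  assumes "i \<in> {1..n}"
  shows "f i z \<le> f i y"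
  using moreau_envelope.above_tangent[OF envelope, OF assms, of z y] grad_zero[OF assms] by simp

text \<open>The competitor \<open>z\<close> itself gives one inequality, minimality of
  \<open>z\<close> for \<open>f i\<close> the other.\<close>

lemma moreau_at_minimizer:
  assumes "i \<in> {1..n}"
  shows "moreau \<gamma> (f i) z = f i z"
  using moreau_envelope.moreau_le[OF envelope[OF assms], of z z]
    moreau_envelope.le_moreau[OF envelope f_min, OF assms assms, of z] by simp

lemma moreau_min:
  assumes "i \<in> {1..n}"
  shows "moreau \<gamma> (f i) z \<le> moreau \<gamma> (f i) x"
  unfolding moreau_at_minimizer[OF assms]
  by (rule moreau_envelope.le_moreau[OF envelope f_min, OF assms assms])

lemma M_eq: "M x = 1 / real n * (\<Sum>i=1..n. moreau \<gamma> (f i) x)"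
  by (simp add: avg_moreau_def average_def)

lemma M_min: "M z \<le> M x"
  unfolding avg_moreau_def by (intro average_le_average moreau_min)

lemma INF_M: "(INF y. M y) = M z"
  by (rule cInf_eq_minimum) (auto intro: M_min)

lemma GDERIV_M: "GDERIV M x :> (1 / real n) *\<^sub>R (\<Sum>i=1..n. (1 / \<gamma>) *\<^sub>R (x - prox \<gamma> (f i) x))"
  unfolding avg_moreau_def
  using envelope smooth L_pos by (intro GDERIV_average moreau_envelope.GDERIV_moreau)

lemma grad_M: "grad M x = (1 / real n) *\<^sub>R (\<Sum>i=1..n. (1 / \<gamma>) *\<^sub>R (x - prox \<gamma> (f i) x))"
  by (rule grad_eqI[OF GDERIV_M])

text \<open>Averages the pointwise models of the envelopes: \<open>C\<close> is 0 for the tangent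
  bound and the quadratic term for the smoothness bound. The average of the constant
  \<open>C\<close> is \<open>C\<close> because n >= 1.\<close>

lemma average_quadratic:
  "average n (\<lambda>i y. g i + v i \<bullet> w + C) x = 1 / real n * (\<Sum>i=1..n. g i) + ((1 / real n) *\<^sub>R (\<Sum>i=1..n. v i)) \<bullet> w + C"
  using n_ge_1 by (simp add: average_def sum.distrib inner_sum_left distrib_left)

lemma M_lower: "M x + grad M x \<bullet> (y - x) \<le> M y"
proof -
  \<comment> \<open>The averaged functions ignore their argument: they are the tangents at
    \<open>x\<close>, already evaluated at \<open>y\<close>.\<close>
  have "average n (\<lambda>i _. moreau \<gamma> (f i) x + (1 / \<gamma>) *\<^sub>R (x - prox \<gamma> (f i) x) \<bullet> (y - x) + 0) y \<le> M y"
    unfolding avg_moreau_def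
    by (rule average_le_average) (use moreau_envelope.moreau_lower[OF envelope] in simp)
  then show ?thesis
    unfolding average_quadratic grad_M M_eq by linarith
qed

lemma L_smooth_M: "L_smooth \<kappa> M"
  unfolding L_smooth_def
proof (intro conjI allI)
  show "M differentiable (at x)" for x
    using GDERIV_M unfolding gderiv_def differentiable_def by blast
  fix y x
  have "M y \<le> average n (\<lambda>i _. moreau \<gamma> (f i) x + (1 / \<gamma>) *\<^sub>R (x - prox \<gamma> (f i) x) \<bullet> (y - x)
      + \<kappa> / 2 * (norm (y - x))\<^sup>2) y"
    unfolding avg_moreau_def
    by (rule average_le_average) (use moreau_envelope.moreau_upper[OF envelope smooth L_pos] in \<open>simp add: \<kappa>_def\<close>)
  then show "M y - M x - grad M x \<bullet> (y - x) \<le> \<kappa> / 2 * (norm (y - x))\<^sup>2"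
    unfolding average_quadratic grad_M M_eq by linarith
qed

text \<open>At \<open>z\<close> the linear term of strong convexity drops out, since all gradients
  vanish there.\<close>

lemma average_growth: "\<mu> / 2 * (norm (x - z))\<^sup>2 \<le> average n f x - average n f z"
proof -
  have "GDERIV (average n f) z :> (1 / real n) *\<^sub>R (\<Sum>i=1..n. grad (f i) z)"
    using envelope by (intro GDERIV_average GDERIV_grad moreau_envelope.differentiable)
  then have "grad (average n f) z = 0"
    using grad_eqI grad_zero by fastforce
  then show ?thesis
    using strongly_convex unfolding strongly_convex_def by (metis diff_zero inner_zero_left)
qed

text \<open>Averaging \<open>moreau_growth\<close> with \<open>f i z\<close> as lower bound compares
  the gaps of \<open>f\<close> and \<open>M\<close>; dividing by 1 + \<gamma> L turns \<mu> into
  \<open>c\<close>.\<close>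

lemma M_growth: "c / 2 * (norm (x - z))\<^sup>2 \<le> M x - M z"
proof -
  have "average n (\<lambda>i y. f i y - f i z) x
      \<le> average n (\<lambda>i y. (1 + \<gamma> * L) * (moreau \<gamma> (f i) y - moreau \<gamma> (f i) z)) x"
    using moreau_envelope.moreau_growth[OF envelope smooth L_pos f_min]
    by (intro average_le_average) (simp add: moreau_at_minimizer)
  then have "average n f x - average n f z \<le> (1 + \<gamma> * L) * (M x - M z)"
    unfolding average_mult average_diff by (simp add: avg_moreau_def average_def)
  then have "\<mu> / 2 * (norm (x - z))\<^sup>2 \<le> (M x - M z) * (1 + \<gamma> * L)"
    using average_growth[of x] by (simp only: mult.commute order_trans)
  then have "\<mu> / 2 * (norm (x - z))\<^sup>2 / (1 + \<gamma> * L) \<le> M x - M z"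
    using denom_pos by (simp only: pos_divide_le_eq)
  moreover have "c / 2 * (norm (x - z))\<^sup>2 = \<mu> / 2 * (norm (x - z))\<^sup>2 / (1 + \<gamma> * L)"
    unfolding c_def times_divide_eq_left divide_divide_eq_left by (simp only: mult.commute)
  ultimately show ?thesis by (simp only:)
qed

lemma grad_M_minimizer: "grad M z = 0"
  using L_smooth_grad_bound[OF L_smooth_M \<kappa>_pos M_min, of z] by simp

text \<open>Growth and smoothness at \<open>z\<close> bound the same increment from both sides. This
  supplies the lower bound that makes the least smoothness constant of \<open>M\<close> exist and be
  positive.\<close>

lemma c_le_smoothness:
  assumes "L_smooth K M"
  shows "c \<le> K"
proof -
  \<comment> \<open>A unit vector is needed: on a zero-dimensional space every real would be a
    smoothness constant.\<close>
  obtain b :: 'a where b: "b \<in> Basis"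
    using nonempty_Basis by blast
  have "c / 2 * (norm (z + b - z))\<^sup>2 \<le> M (z + b) - M z"
    by (rule M_growth)
  also have "\<dots> \<le> K / 2 * (norm (z + b - z))\<^sup>2"
    using L_smoothD[OF assms, of "z + b" z] by (simp add: grad_M_minimizer)
  finally show ?thesis
    using b by simp
qed

section \<open>The smoothness constant of the averaged envelope\<close>

abbreviation \<Lambda> where "\<Lambda> \<equiv> smoothness_const M"

lemma L_smooth_\<Lambda>: "L_smooth \<Lambda> M"
  by (rule L_smooth_smoothness_const[OF L_smooth_M c_le_smoothness])

lemma \<Lambda>_le: "\<Lambda> \<le> \<kappa>"
  by (rule smoothness_const_le[OF L_smooth_M c_le_smoothness L_smooth_M])

lemma c_le_\<Lambda>: "c \<le> \<Lambda>"
  by (rule c_le_smoothness[OF L_smooth_\<Lambda>])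

lemma \<Lambda>_pos: "\<Lambda> > 0"
  using c_le_\<Lambda> c_pos by linarith

text \<open>\<gamma> \<kappa> = \<gamma> L / (1 + \<gamma> L) is below 1. Hence the largest allowed
  extrapolation parameter exceeds 1.\<close>

lemma \<gamma>_\<Lambda>_less_1: "\<gamma> * \<Lambda> < 1"
proof -
  have "\<gamma> * \<Lambda> \<le> \<gamma> * \<kappa>"
    using \<Lambda>_le \<gamma>_pos by (intro mult_left_mono) auto
  also have "\<dots> < 1"
    using denom_pos by (simp add: \<kappa>_def)
  finally show ?thesis .
qed

text \<open>The gradient bound is applied to each envelope separately, which works because
  \<open>z\<close> minimizes all of them. The squares are averaged, not the vectors, since each
  client's error is relative to its own displacement.\<close>

lemma average_grad_bound:
  "1 / real n * (\<Sum>i=1..n. (norm ((1 / \<gamma>) *\<^sub>R (x - prox \<gamma> (f i) x)))\<^sup>2) \<le> 2 * \<kappa> * (M x - M z)"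
proof -
  have "(norm ((1 / \<gamma>) *\<^sub>R (x - prox \<gamma> (f i) x)))\<^sup>2 \<le> 2 * \<kappa> * (moreau \<gamma> (f i) x - moreau \<gamma> (f i) z)"
    if i: "i \<in> {1..n}" for i
  proof -
    interpret moreau_envelope "f i" \<gamma> by (rule envelope[OF i])
    show ?thesis
      using L_smooth_grad_bound[OF L_smooth_moreau[OF smooth[OF i] L_pos, folded \<kappa>_def] \<kappa>_pos moreau_min[OF i], of x]
      by (simp only: grad_moreau[OF smooth[OF i] L_pos])
  qed
  then have "average n (\<lambda>i y. (norm ((1 / \<gamma>) *\<^sub>R (y - prox \<gamma> (f i) y)))\<^sup>2) x
      \<le> average n (\<lambda>i y. 2 * \<kappa> * (moreau \<gamma> (f i) y - moreau \<gamma> (f i) z)) x"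
    by (rule average_le_average)
  then show ?thesis
    unfolding average_mult average_diff by (simp add: avg_moreau_def average_def)
qed

text \<open>In units of s \<delta>, the exact gradient gains c / 4 (one half from descent, c / 2
  from the Polyak-Lojasiewicz inequality) and the error costs \<epsilon> \<kappa>.\<close>

lemma fedexprox_step:
  assumes step: "inexact_fedexprox n f \<gamma> \<epsilon> \<alpha> xt x"
    and \<alpha>: "\<alpha> > 0" "\<alpha> * \<gamma> * \<Lambda> \<le> 1" and \<epsilon>: "\<epsilon> \<ge> 0"
  shows "M (x (Suc k)) - M z \<le> (1 - \<alpha> * \<gamma> * (c / 4 - \<epsilon> * \<kappa>)) * (M (x k) - M z)"
proof -
  define s \<delta> where "s = \<alpha> * \<gamma>" and "\<delta> = M (x k) - M z"
  define p where "p i = prox \<gamma> (f i) (x k)" for i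
  define e where "e = (1 / real n) *\<^sub>R (\<Sum>i=1..n. (1 / \<gamma>) *\<^sub>R (p i - xt i (Suc k)))"
  have s: "s > 0" "s * \<Lambda> \<le> 1"
    using \<alpha> \<gamma>_pos by (auto simp: s_def)
  \<comment> \<open>Adding \<open>e\<close> cancels the exact proximal points and puts the computed
    ones in their place.\<close>
  have "grad M (x k) + e = (1 / real n) *\<^sub>R (\<Sum>i=1..n. (1 / \<gamma>) *\<^sub>R (x k - xt i (Suc k)))"
    unfolding grad_M e_def p_def
    by (simp flip: scaleR_add_right sum.distrib)
  also have "\<dots> = (1 / \<gamma>) *\<^sub>R (x k - (1 / real n) *\<^sub>R (\<Sum>i=1..n. xt i (Suc k)))"
    using n_ge_1
    by (simp add: sum_subtractf scaleR_diff_right sum_constant_scaleR flip: scaleR_sum_right)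
  finally have "s *\<^sub>R (grad M (x k) + e) = \<alpha> *\<^sub>R (x k - (1 / real n) *\<^sub>R (\<Sum>i=1..n. xt i (Suc k)))"
    using \<gamma>_pos by (simp add: s_def)
  moreover have "x (Suc k) = x k + \<alpha> *\<^sub>R ((1 / real n) *\<^sub>R (\<Sum>i=1..n. xt i (Suc k)) - x k)"
    using step unfolding inexact_fedexprox_def by blast
  ultimately have "x (Suc k) = x k - s *\<^sub>R (grad M (x k) + e)"
    by (simp add: scaleR_diff_right)
  then have descent: "M (x (Suc k)) \<le> M (x k) - s / 2 * (norm (grad M (x k)))\<^sup>2 + s / 2 * (norm e)\<^sup>2"
    using inexact_gradient_step[OF L_smooth_\<Lambda> s] by simp
  \<comment> \<open>Three bounds in turn: convexity of the squared norm, the relative accuracy of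
    each client, and the averaged gradient bound.\<close>
  have "(norm e)\<^sup>2 \<le> 1 / real n * (\<Sum>i=1..n. (norm ((1 / \<gamma>) *\<^sub>R (p i - xt i (Suc k))))\<^sup>2)"
    unfolding e_def by (rule norm_average_le)
  also have "\<dots> \<le> 1 / real n * (\<Sum>i=1..n. \<epsilon> * (norm ((1 / \<gamma>) *\<^sub>R (x k - p i)))\<^sup>2)"
  proof (intro mult_left_mono sum_mono)
    fix i assume "i \<in> {1..n}"
    then have "(norm (p i - xt i (Suc k)))\<^sup>2 \<le> \<epsilon> * (norm (x k - p i))\<^sup>2"
      using step by (simp add: inexact_fedexprox_def p_def norm_minus_commute)
    then have "(1 / \<gamma>)\<^sup>2 * (norm (p i - xt i (Suc k)))\<^sup>2 \<le> (1 / \<gamma>)\<^sup>2 * (\<epsilon> * (norm (x k - p i))\<^sup>2)"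
      by (intro mult_left_mono) auto
    then show "(norm ((1 / \<gamma>) *\<^sub>R (p i - xt i (Suc k))))\<^sup>2 \<le> \<epsilon> * (norm ((1 / \<gamma>) *\<^sub>R (x k - p i)))\<^sup>2"
      by (simp add: power_mult_distrib power_divide)
  qed simp
  also have "\<dots> = \<epsilon> * (1 / real n * (\<Sum>i=1..n. (norm ((1 / \<gamma>) *\<^sub>R (x k - p i)))\<^sup>2))"
    by (simp flip: sum_distrib_left)
  also have "\<dots> \<le> \<epsilon> * (2 * \<kappa> * \<delta>)"
    unfolding p_def \<delta>_def using \<epsilon> by (rule mult_left_mono[OF average_grad_bound])
  finally have err: "s / 2 * (norm e)\<^sup>2 \<le> s / 2 * (\<epsilon> * (2 * \<kappa> * \<delta>))"
    using s by (intro mult_left_mono) auto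
  have "s / 2 * (c / 2 * \<delta>) \<le> s / 2 * (norm (grad M (x k)))\<^sup>2"
    using s quadratic_growth_imp_PL[of M "x k" "grad M (x k)" z c, OF M_lower c_pos M_growth]
    by (intro mult_left_mono) (auto simp: \<delta>_def)
  then have "M (x (Suc k)) - M z \<le> \<delta> - s / 2 * (c / 2 * \<delta>) + s / 2 * (\<epsilon> * (2 * \<kappa> * \<delta>))"
    using descent err unfolding \<delta>_def by linarith
  also have "\<dots> = (1 - s * (c / 4 - \<epsilon> * \<kappa>)) * \<delta>"
    by (simp add: algebra_simps)
  finally show ?thesis
    by (simp only: s_def \<delta>_def)
qed

text \<open>The bracket is at most c / 4, hence at most \<open>\<Lambda>\<close>, and \<alpha>
  \<gamma> \<Lambda> <= 1. Nonnegativity is what allows the one-step bound to be iterated.\<close>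

lemma rate_nonneg:
  assumes \<alpha>: "\<alpha> > 0" "\<alpha> * \<gamma> * \<Lambda> \<le> 1" and \<epsilon>: "\<epsilon> \<ge> 0"
  shows "0 \<le> 1 - \<alpha> * \<gamma> * (c / 4 - \<epsilon> * \<kappa>)"
proof -
  have "c / 4 - \<epsilon> * \<kappa> \<le> \<Lambda>"
    using c_le_\<Lambda> c_pos mult_nonneg_nonneg[OF \<epsilon> less_imp_le[OF \<kappa>_pos]] by linarith
  then have "\<alpha> * \<gamma> * (c / 4 - \<epsilon> * \<kappa>) \<le> \<alpha> * \<gamma> * \<Lambda>"
    using \<alpha>(1) \<gamma>_pos by (intro mult_left_mono) auto
  then show ?thesis
    using \<alpha>(2) by linarith
qed

section \<open>Rates after K steps\<close>

lemma fedexprox_linear_rate: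
  assumes step: "inexact_fedexprox n f \<gamma> \<epsilon> \<alpha> xt x"
    and \<alpha>: "\<alpha> > 0" "\<alpha> * \<gamma> * \<Lambda> \<le> 1" and \<epsilon>: "\<epsilon> \<ge> 0"
  shows "M (x K) - M z \<le> (1 - \<alpha> * \<gamma> * (c / 4 - \<epsilon> * \<kappa>)) ^ K * (M (x 0) - M z)"
proof (induction K)
  case (Suc K)
  have "M (x (Suc K)) - M z \<le> (1 - \<alpha> * \<gamma> * (c / 4 - \<epsilon> * \<kappa>)) * (M (x K) - M z)"
    by (rule fedexprox_step[OF assms])
  also have "\<dots> \<le> (1 - \<alpha> * \<gamma> * (c / 4 - \<epsilon> * \<kappa>))
      * ((1 - \<alpha> * \<gamma> * (c / 4 - \<epsilon> * \<kappa>)) ^ K * (M (x 0) - M z))"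
    using Suc rate_nonneg[OF \<alpha> \<epsilon>] by (rule mult_left_mono)
  finally show ?case
    by (simp only: power_Suc mult.assoc)
qed simp

text \<open>Growth bounds the final gap from below by c / 2 times the squared distance, smoothness
  at \<open>z\<close> bounds the initial gap from above by \<open>\<Lambda>\<close> / 2 times it;
  the quotient is the extra factor.\<close>

lemma fedexprox_distance_rate:
  assumes step: "inexact_fedexprox n f \<gamma> \<epsilon> \<alpha> xt x"
    and \<alpha>: "\<alpha> > 0" "\<alpha> * \<gamma> * \<Lambda> \<le> 1" and \<epsilon>: "\<epsilon> \<ge> 0"
  shows "(norm (x K - z))\<^sup>2 \<le> (1 - \<alpha> * \<gamma> * (c / 4 - \<epsilon> * \<kappa>)) ^ K * (\<Lambda> / c) * (norm (x 0 - z))\<^sup>2"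
proof -
  let ?\<rho> = "1 - \<alpha> * \<gamma> * (c / 4 - \<epsilon> * \<kappa>)"
  have "c / 2 * (norm (x K - z))\<^sup>2 \<le> ?\<rho> ^ K * (M (x 0) - M z)"
    using M_growth[of "x K"] fedexprox_linear_rate[OF assms] by (rule order_trans)
  also have "\<dots> \<le> ?\<rho> ^ K * (\<Lambda> / 2 * (norm (x 0 - z))\<^sup>2)"
    using L_smoothD[OF L_smooth_\<Lambda>, of "x 0" z] rate_nonneg[OF \<alpha> \<epsilon>]
    by (intro mult_left_mono) (auto simp: grad_M_minimizer)
  also have "c / 2 * (norm (x K - z))\<^sup>2 = (norm (x K - z))\<^sup>2 * c / 2"
    by simp
  also have "?\<rho> ^ K * (\<Lambda> / 2 * (norm (x 0 - z))\<^sup>2) = ?\<rho> ^ K * \<Lambda> * (norm (x 0 - z))\<^sup>2 / 2"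
    by simp
  finally have "(norm (x K - z))\<^sup>2 * c \<le> ?\<rho> ^ K * \<Lambda> * (norm (x 0 - z))\<^sup>2"
    by linarith
  then have "(norm (x K - z))\<^sup>2 \<le> ?\<rho> ^ K * \<Lambda> * (norm (x 0 - z))\<^sup>2 / c"
    using c_pos by (simp only: pos_le_divide_eq)
  then show ?thesis by simp
qed

text \<open>Identifies an arbitrary minimizer of the average with the common critical point
  \<open>z\<close>, around which growth holds.\<close>

lemma average_minimizer_unique:
  assumes "\<And>y. average n f w \<le> average n f y"
  shows "w = z"
proof -
  have "\<mu> / 2 * (norm (w - z))\<^sup>2 \<le> 0"
    using average_growth[of w] assms[of z] by linarith
  then show ?thesis
    using \<mu>_pos by (simp add: mult_le_0_iff)
qed

end

section \<open>Convergence in terms of the extrapolation parameter\<close>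

theorem theorem3:
  fixes f :: "nat \<Rightarrow> real ^ 'd \<Rightarrow> real"
    and n :: nat and L :: "nat \<Rightarrow> real" and L\<^sub>m\<^sub>a\<^sub>x \<mu> \<gamma> \<epsilon>\<^sub>2 L\<^sub>\<gamma> :: real
    and \<E> :: "real ^ 'd \<Rightarrow> real"
  assumes "n \<ge> 1"
    and "\<And>i. i \<in> {1..n} \<Longrightarrow> f i differentiable_on UNIV"
    and "\<And>i. i \<in> {1..n} \<Longrightarrow> bdd_below (range (f i))"
    and "\<exists>z. \<forall>i\<in>{1..n}. grad (f i) z = 0"
    and "\<And>i. i \<in> {1..n} \<Longrightarrow> convex_on UNIV (f i)"
    and "\<And>i. i \<in> {1..n} \<Longrightarrow> L i > 0"
    and "\<And>i. i \<in> {1..n} \<Longrightarrow> L_smooth (L i) (f i)"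
    and "L\<^sub>m\<^sub>a\<^sub>x = Max (L ` {1..n})"
    and "\<mu> > 0"
    and "strongly_convex \<mu> (average n f)"
    and "\<gamma> > 0"
    and "0 \<le> \<epsilon>\<^sub>2" and "\<epsilon>\<^sub>2 < \<mu> / (4 * L\<^sub>m\<^sub>a\<^sub>x)"
    and "L\<^sub>\<gamma> = smoothness_const (avg_moreau n \<gamma> f)"
    and "\<And>y. \<E> y = \<gamma> * avg_moreau n \<gamma> f y - \<gamma> * (INF z. avg_moreau n \<gamma> f z)"
  shows "(\<forall>\<alpha> xt x. 0 < \<alpha> \<and> \<alpha> \<le> 1 / (\<gamma> * L\<^sub>\<gamma>) \<and> inexact_fedexprox n f \<gamma> \<epsilon>\<^sub>2 \<alpha> xt x \<longrightarrow>
            (\<forall>K. \<E> (x K) \<le> (1 - (1 - 4 * \<epsilon>\<^sub>2 * L\<^sub>m\<^sub>a\<^sub>x / \<mu>)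
                               * (\<gamma> * \<mu> / (4 * (1 + \<gamma> * L\<^sub>m\<^sub>a\<^sub>x))) * \<alpha>) ^ K * \<E> (x 0)))
       \<and> 1 / (\<gamma> * L\<^sub>\<gamma>) > 1
       \<and> (\<forall>xt x x\<^sub>s. inexact_fedexprox n f \<gamma> \<epsilon>\<^sub>2 (1 / (\<gamma> * L\<^sub>\<gamma>)) xt x
              \<and> (\<forall>y. average n f x\<^sub>s \<le> average n f y) \<longrightarrow>
            (\<forall>K. (norm (x K - x\<^sub>s))\<^sup>2
                   \<le> (1 - (1 - 4 * \<epsilon>\<^sub>2 * L\<^sub>m\<^sub>a\<^sub>x / \<mu>)
                           * (\<mu> / (4 * L\<^sub>\<gamma> * (1 + \<gamma> * L\<^sub>m\<^sub>a\<^sub>x)))) ^ K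
                      * (L\<^sub>\<gamma> * (1 + \<gamma> * L\<^sub>m\<^sub>a\<^sub>x) / \<mu>) * (norm (x 0 - x\<^sub>s))\<^sup>2))"
proof -
  obtain z where z: "\<And>i. i \<in> {1..n} \<Longrightarrow> grad (f i) z = 0"
    using assms(4) by blast
  have L_le: "L i \<le> L\<^sub>m\<^sub>a\<^sub>x" if "i \<in> {1..n}" for i
    using that by (simp add: assms(8))
  have "1 \<in> {1..n}"
    using assms(1) by simp
  then have L_pos: "L\<^sub>m\<^sub>a\<^sub>x > 0"
    using assms(6) L_le by (meson less_le_trans)
  \<comment> \<open>The largest L i serves as the smoothness constant shared by all
    functions.\<close>
  interpret interpolated_sum n f L\<^sub>m\<^sub>a\<^sub>x \<mu> \<gamma> z
  proof (rule interpolated_sum.intro)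
    fix i assume i: "i \<in> {1..n}"
    show "moreau_envelope (f i) \<gamma>"
      using assms(2)[OF i] assms(3)[OF i] assms(5)[OF i] assms(11)
      by unfold_locales (auto simp: differentiable_on_def)
    show "L_smooth L\<^sub>m\<^sub>a\<^sub>x (f i)"
      using assms(7)[OF i] L_le[OF i] by (rule L_smooth_mono)
    show "grad (f i) z = 0"
      using i by (rule z)
  qed (use assms(1) L_pos assms(9-11) in auto)
  have L\<gamma>: "L\<^sub>\<gamma> = \<Lambda>"
    by (rule assms(14))
  have \<E>: "\<E> y = \<gamma> * (M y - M z)" for y
    unfolding assms(15) INF_M by (simp add: right_diff_distrib)
  \<comment> \<open>Here \<gamma> \<mu> / (4 (1 + \<gamma> L)) is \<gamma> c / 4, and multiplying c
    / 4 by 4 \<epsilon> L / \<mu> gives \<epsilon> \<kappa>, where L stands for the maximum.\<close>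
  have rate: "1 - (1 - 4 * \<epsilon>\<^sub>2 * L\<^sub>m\<^sub>a\<^sub>x / \<mu>) * (\<gamma> * \<mu> / (4 * (1 + \<gamma> * L\<^sub>m\<^sub>a\<^sub>x))) * \<alpha>
      = 1 - \<alpha> * \<gamma> * (c / 4 - \<epsilon>\<^sub>2 * \<kappa>)" for \<alpha>
    unfolding c_def \<kappa>_def using \<mu>_pos denom_pos by (simp add: divide_simps) (simp add: algebra_simps)
  show ?thesis
    unfolding L\<gamma>
  proof (intro conjI allI impI; (elim conjE)?)
    fix \<alpha> xt x K
    assume \<alpha>: "0 < \<alpha>" "\<alpha> \<le> 1 / (\<gamma> * \<Lambda>)" and step: "inexact_fedexprox n f \<gamma> \<epsilon>\<^sub>2 \<alpha> xt x"
    have "\<alpha> * \<gamma> * \<Lambda> \<le> 1"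
      using \<alpha>(2) \<gamma>_pos \<Lambda>_pos by (simp add: pos_le_divide_eq mult.assoc)
    then have "\<gamma> * (M (x K) - M z) \<le> \<gamma> * ((1 - \<alpha> * \<gamma> * (c / 4 - \<epsilon>\<^sub>2 * \<kappa>)) ^ K * (M (x 0) - M z))"
      using fedexprox_linear_rate[OF step \<alpha>(1) _ assms(12)] \<gamma>_pos by (intro mult_left_mono) auto
    then show "\<E> (x K) \<le> (1 - (1 - 4 * \<epsilon>\<^sub>2 * L\<^sub>m\<^sub>a\<^sub>x / \<mu>) * (\<gamma> * \<mu> / (4 * (1 + \<gamma> * L\<^sub>m\<^sub>a\<^sub>x))) * \<alpha>) ^ K * \<E> (x 0)"
      unfolding rate \<E> by (simp only: mult.left_commute)
  next
    show "1 / (\<gamma> * \<Lambda>) > 1"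
      using \<gamma>_pos \<Lambda>_pos \<gamma>_\<Lambda>_less_1 by simp
  next
    fix xt x x\<^sub>s K
    assume step: "inexact_fedexprox n f \<gamma> \<epsilon>\<^sub>2 (1 / (\<gamma> * \<Lambda>)) xt x"
      and "\<forall>y. average n f x\<^sub>s \<le> average n f y"
    then have xs: "x\<^sub>s = z"
      using average_minimizer_unique by blast
    have \<alpha>: "1 / (\<gamma> * \<Lambda>) > 0" "1 / (\<gamma> * \<Lambda>) * \<gamma> * \<Lambda> \<le> 1"
      using \<gamma>_pos \<Lambda>_pos by auto
    \<comment> \<open>This is \<open>rate\<close> at \<alpha> = 1 / (\<gamma> \<Lambda>), where
      \<gamma> cancels.\<close>
    have rate': "1 - (1 - 4 * \<epsilon>\<^sub>2 * L\<^sub>m\<^sub>a\<^sub>x / \<mu>) * (\<mu> / (4 * \<Lambda> * (1 + \<gamma> * L\<^sub>m\<^sub>a\<^sub>x)))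
        = 1 - 1 / (\<gamma> * \<Lambda>) * \<gamma> * (c / 4 - \<epsilon>\<^sub>2 * \<kappa>)"
      unfolding rate[symmetric] using \<gamma>_pos by (simp add: mult_ac)
    show "(norm (x K - x\<^sub>s))\<^sup>2
        \<le> (1 - (1 - 4 * \<epsilon>\<^sub>2 * L\<^sub>m\<^sub>a\<^sub>x / \<mu>) * (\<mu> / (4 * \<Lambda> * (1 + \<gamma> * L\<^sub>m\<^sub>a\<^sub>x)))) ^ K
          * (\<Lambda> * (1 + \<gamma> * L\<^sub>m\<^sub>a\<^sub>x) / \<mu>) * (norm (x 0 - x\<^sub>s))\<^sup>2"
      using fedexprox_distance_rate[OF step \<alpha> assms(12), of K] unfolding rate' xs by (simp add: c_def)
  qed
qed

end
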